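(* Let $a\in\mathbb{H}$ with $\operatorname{Im}a\neq0$, let $c\in\mathbb{R}$, and $L(x)=ax-xa+c$. Put $c_0=|c|/|\operatorname{Im}a|$. Then \[m_{\mathbb{H}}(L)=\log|\operatorname{Im}a|+\frac18\Big((4+c_0^2)\log(4+c_0^2)-2c_0^2\log c_0-4\Big),\] with the convention $0\log0=0$.
   Context: $\mathbb{H}$ denotes the quaternions; $m_{\mathbb{H}}(L)=\int_{|x|=1}\log|L(x)|\,d\mu(x)$ with $\mu$ the probability Haar measure on unit quaternions; $ax-xa$ uses (non-commutative) quaternion multiplication. *)

theory Defs
  imports "HOL-Analysis.Analysis"
begin

text \<open>Quaternions are modelled as R^4 = real x real x real x real, the tuple (a,b,c,d)
  standing for a + b i + c j + d k.  The norm of the product type is the Euclidean norm,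
  i.e. the quaternion absolute value.\<close>

type_synonym quat = "real \<times> real \<times> real \<times> real"

fun qmul :: "quat \<Rightarrow> quat \<Rightarrow> quat" where
  "qmul (a1, b1, c1, d1) (a2, b2, c2, d2) =
     (a1*a2 - b1*b2 - c1*c2 - d1*d2,
      a1*b2 + b1*a2 + c1*d2 - d1*c2,
      a1*c2 - b1*d2 + c1*a2 + d1*b2,
      a1*d2 + b1*c2 - c1*b2 + d1*a2)"

definition qreal :: "real \<Rightarrow> quat" where
  "qreal r = (r, 0, 0, 0)"

fun qIm :: "quat \<Rightarrow> quat" where
  "qIm (a, b, c, d) = (0, b, c, d)"

text \<open>Integral against the probability Haar measure on the unit quaternions S^3, which is
  the normalized rotation-invariant surface measure; realised as the cone measure:
  integral over S^3 of f = (1/vol B) * integral over the unit ball B of f(x/|x|).\<close>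
definition haar_integral :: "(quat \<Rightarrow> real) \<Rightarrow> real" where
  "haar_integral f =
     (LINT x : ball 0 1 | lborel. f (x /\<^sub>R norm x)) / measure lborel (ball (0::quat) 1)"

definition mahler_H :: "(quat \<Rightarrow> quat) \<Rightarrow> real" where
  "mahler_H L = haar_integral (\<lambda>x. ln (norm (L x)))"

end

theory Submission
  imports Defs "HOL-Real_Asymp.Real_Asymp"
begin

text \<open>Since \<open>ax - xa\<close> is twice the cross product of the imaginary parts, \<open>|L(x)|\<^sup>2 = c\<^sup>2 + 4 |Im a|\<^sup>2 s(x)\<close>
  for a unit quaternion \<open>x\<close>, where \<open>s(x)\<close> is the squared length of the projection of \<open>x\<close> to the plane
  orthogonal to \<open>1\<close> and \<open>Im a\<close>. After a reflection that plane is a coordinate plane. The pushforward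
  of Lebesgue measure on \<open>\<real>\<^sup>2 \<times> \<real>\<^sup>2\<close> under \<open>(y, z) \<mapsto> (|y|\<^sup>2, |z|\<^sup>2)\<close> is \<open>\<pi>\<^sup>2\<close> times Lebesgue measure on the
  quadrant, and \<open>q/(p+q)\<close> is uniformly distributed on the triangle \<open>p + q < 1\<close>. Hence \<open>s\<close> is
  uniformly distributed on \<open>[0, 1]\<close>, and it remains to integrate \<open>\<onehalf> ln (c\<^sup>2 + 4 |Im a|\<^sup>2 s)\<close>.\<close>

section \<open>Invariance of Lebesgue measure under translations and orthogonal maps\<close>

lemma nn_integral_lborel_plus:
  fixes c :: "'a::euclidean_space"
  assumes [measurable]: "f \<in> borel_measurable borel"
  shows "(\<integral>\<^sup>+x. f (c + x) \<partial>lborel) = (\<integral>\<^sup>+x. f x \<partial>lborel)"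
proof -
  have "(\<integral>\<^sup>+x. f x \<partial>distr lborel borel ((+) c)) = (\<integral>\<^sup>+x. f (c + x) \<partial>lborel)"
    by (rule nn_integral_distr) auto
  then show ?thesis
    by (simp add: lborel_distr_plus)
qed

lemma nn_integral_lborel_Fubini:
  fixes f :: "'a::euclidean_space \<Rightarrow> 'b::euclidean_space \<Rightarrow> ennreal"
  assumes "case_prod f \<in> borel_measurable borel"
  shows "(\<integral>\<^sup>+x. \<integral>\<^sup>+y. f x y \<partial>lborel \<partial>lborel) = (\<integral>\<^sup>+y. \<integral>\<^sup>+x. f x y \<partial>lborel \<partial>lborel)"
proof -
  have "case_prod f \<in> borel_measurable (lborel \<Otimes>\<^sub>M lborel)"
    using assms by (simp add: lborel_prod)
  from lborel_pair.Fubini'[OF this] show ?thesis by simp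
qed

lemma nn_integral_lborel_prod:
  fixes f :: "'a::euclidean_space \<times> 'b::euclidean_space \<Rightarrow> ennreal"
  assumes "f \<in> borel_measurable borel"
  shows "(\<integral>\<^sup>+z. f z \<partial>lborel) = (\<integral>\<^sup>+x. \<integral>\<^sup>+y. f (x, y) \<partial>lborel \<partial>lborel)"
proof -
  have "f \<in> borel_measurable (lborel \<Otimes>\<^sub>M lborel)"
    using assms by (simp add: lborel_prod)
  from lborel.nn_integral_fst[OF this] show ?thesis by (simp add: lborel_prod)
qed

lemma borel_measurable_orthogonal_transformation:
  fixes f :: "'a::euclidean_space \<Rightarrow> 'a"
  assumes "orthogonal_transformation f"
  shows "f \<in> borel_measurable borel"
  using assms
  by (intro borel_measurable_continuous_onI linear_continuous_on
      linear_conv_bounded_linear[THEN iffD1] orthogonal_transformation_linear)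

text \<open>Uniqueness of translation-invariant measures: the pushforward \<open>\<mu>\<close> is translation invariant, so
  a double application of Fubini's theorem gives \<open>\<mu>(A) \<lambda>(B) = \<lambda>(A) \<mu>(B)\<close>, and \<open>\<mu>(B) = \<lambda>(B)\<close> for the
  unit ball \<open>B\<close>.\<close>

lemma distr_orthogonal_transformation_lborel:
  fixes f :: "'a::euclidean_space \<Rightarrow> 'a"
  assumes f: "orthogonal_transformation f"
  shows "distr lborel borel f = lborel"
proof (rule measure_eqI)
  have [measurable]: "f \<in> borel_measurable borel"
    using f by (rule borel_measurable_orthogonal_transformation)
  obtain g where g: "\<And>x. f (g x) = x" "\<And>x. g (f x) = x"
    using orthogonal_transformation_bij[OF f]
    by (metis bij_inv_eq_iff)
  have fadd: "f (x + y) = f x + f y" for x y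
    using f by (simp add: orthogonal_transformation_linear linear_add)
  show "sets (distr lborel borel f) = sets lborel" by simp
  fix A :: "'a set" assume "A \<in> sets (distr lborel borel f)"
  then have A[measurable]: "A \<in> sets borel" by simp
  define B where "B = ball (0::'a) 1"
  have B[measurable]: "B \<in> sets borel" by (simp add: B_def)
  let ?m = "\<lambda>S. \<integral>\<^sup>+x. indicator S (f x) \<partial>lborel"
  have m: "?m S = emeasure (distr lborel borel f) S" if "S \<in> sets borel" for S
    using that by (subst nn_integral_indicator[symmetric], simp, subst nn_integral_distr) auto
  \<comment> \<open>Invariance under the point reflection \<open>y \<mapsto> x - y\<close>, the
    affine map with factor -1; it evaluates the inner integral once the order of integration is
    swapped back.\<close>
  have refl: "(\<integral>\<^sup>+y. indicator A (x - y) \<partial>lborel) = emeasure lborel A" for x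
  proof -
    have "emeasure lborel A = (\<integral>\<^sup>+y. indicator A y \<partial>lborel)" by simp
    also have "\<dots> = (\<integral>\<^sup>+y. indicator A y \<partial>density (distr lborel borel (\<lambda>y. x + (-1) *\<^sub>R y)) (\<lambda>_. 1))"
      using lborel_affine[of "-1" x] by simp
    also have "\<dots> = (\<integral>\<^sup>+y. indicator A (x - y) \<partial>lborel)"
      by (simp add: density_1 nn_integral_distr del: nn_integral_indicator)
    finally show ?thesis by simp
  qed
  have "?m A * emeasure lborel B = (\<integral>\<^sup>+x. indicator A (f x) * (\<integral>\<^sup>+y. indicator B y \<partial>lborel) \<partial>lborel)"
    by (simp add: nn_integral_multc)
  also have "\<dots> = (\<integral>\<^sup>+x. indicator A (f x) * (\<integral>\<^sup>+y. indicator B (f x + y) \<partial>lborel) \<partial>lborel)"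
    by (simp only: nn_integral_lborel_plus borel_measurable_indicator B)
  also have "\<dots> = (\<integral>\<^sup>+x. \<integral>\<^sup>+y. indicator A (f x) * indicator B (f x + y) \<partial>lborel \<partial>lborel)"
    by (simp add: nn_integral_cmult)
  also have "\<dots> = (\<integral>\<^sup>+y. \<integral>\<^sup>+x. indicator A (f x) * indicator B (f x + y) \<partial>lborel \<partial>lborel)"
    by (rule nn_integral_lborel_Fubini) (simp add: borel_prod[symmetric] split_beta')
  \<comment> \<open>For fixed \<open>y\<close>, the shift of \<open>x\<close> by the preimage of
    \<open>- y\<close> moves the summand \<open>y\<close> from the argument of \<open>B\<close> to
    that of \<open>A\<close>.\<close>
  also have "\<dots> = (\<integral>\<^sup>+y. \<integral>\<^sup>+x. indicator A (f (g (- y) + x)) * indicator B (f (g (- y) + x) + y) \<partial>lborel \<partial>lborel)"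
    by (intro nn_integral_cong nn_integral_lborel_plus[symmetric]) simp
  also have "\<dots> = (\<integral>\<^sup>+y. \<integral>\<^sup>+x. indicator A (f x - y) * indicator B (f x) \<partial>lborel \<partial>lborel)"
    by (simp add: fadd g algebra_simps)
  also have "\<dots> = (\<integral>\<^sup>+x. \<integral>\<^sup>+y. indicator A (f x - y) * indicator B (f x) \<partial>lborel \<partial>lborel)"
    by (rule nn_integral_lborel_Fubini) (simp add: borel_prod[symmetric] split_beta')
  also have "\<dots> = emeasure lborel A * ?m B"
    by (simp add: nn_integral_multc refl nn_integral_cmult)
  also have "?m B = (\<integral>\<^sup>+x. indicator B x \<partial>lborel)"
    using f by (intro nn_integral_cong) (simp add: B_def orthogonal_transformation_norm indicator_def)
  also have "\<dots> = emeasure lborel B"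
    by simp
  finally have "?m A * emeasure lborel B = emeasure lborel A * emeasure lborel B" .
  moreover have "emeasure lborel B \<noteq> \<infinity>" "emeasure lborel B \<noteq> 0"
    unfolding B_def using emeasure_lborel_ball_finite[of "0::'a" 1]
    by (auto simp: emeasure_ball unit_ball_vol_pos less_imp_neq[symmetric])
  ultimately show "emeasure (distr lborel borel f) A = emeasure lborel A"
    by (simp add: m mult.commute[of _ "emeasure lborel B"] ennreal_mult_cancel_left)
qed

section \<open>Squared radii in two planes and the ratio on the triangle\<close>

text \<open>A disc of radius \<open>sqrt t\<close> has area \<open>pi * t\<close>, so both measures
  agree on the half-lines \<open>{..<t}\<close>, an intersection-stable generator of the Borel
  sets.\<close>

lemma distr_norm_sq_plane:
  "distr lborel borel (\<lambda>z::real \<times> real. (norm z)\<^sup>2) = density lborel (\<lambda>t. ennreal pi * indicator {0..} t)"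
    (is "?M = ?N")
proof (rule measure_eqI_generator_eq[where E="range lessThan" and \<Omega>=UNIV and A="\<lambda>i. {..<real i}"])
  have M: "emeasure ?M {..<t} = ennreal (pi * max 0 t)" for t
  proof -
    \<comment> \<open>The maximum covers negative \<open>t\<close>, where the ball has radius 0 and
      is empty.\<close>
    have "(norm z)\<^sup>2 < t \<longleftrightarrow> norm z < sqrt (max 0 t)" for z :: "real \<times> real"
    proof (cases "0 \<le> t")
      case True
      have "(norm z)\<^sup>2 < t \<longleftrightarrow> sqrt ((norm z)\<^sup>2) < sqrt t"
        by (simp only: real_sqrt_less_iff)
      with True show ?thesis by simp
    next
      case False
      then show ?thesis by (simp add: not_less order_trans[OF _ zero_le_power2])
    qed
    then have "(\<lambda>z::real \<times> real. (norm z)\<^sup>2) -` {..<t} = ball 0 (sqrt (max 0 t))"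
      by auto
    then show ?thesis
      by (simp add: emeasure_distr emeasure_ball unit_ball_vol_2)
  qed
  have N: "emeasure ?N {..<t} = ennreal (pi * max 0 t)" for t
  proof -
    have "emeasure ?N {..<t} = (\<integral>\<^sup>+x. ennreal pi * indicator {0..<t} x \<partial>lborel)"
      by (subst emeasure_density) (auto intro!: nn_integral_cong simp: indicator_def)
    also have "\<dots> = ennreal pi * emeasure lborel {0..<t}"
      by (simp add: nn_integral_cmult)
    finally show ?thesis
      by (cases "t \<ge> 0") (auto simp: ennreal_mult max_def)
  qed
  show "emeasure ?M X = emeasure ?N X" if "X \<in> range lessThan" for X
    using that M N by auto
  show "Int_stable (range (lessThan :: real \<Rightarrow> _))"
    unfolding Int_stable_def by (auto intro: range_eqI[where x="min a b" for a b])
  show "sets ?M = sigma_sets UNIV (range lessThan)"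
    by (simp add: borel_Iio)
  show "sets ?N = sigma_sets UNIV (range lessThan)"
    by (simp add: borel_Iio)
  show "(\<Union>i. {..<real i}) = UNIV"
    using reals_Archimedean2 by auto
  show "emeasure ?M {..<real i} \<noteq> \<infinity>" for i
    by (simp add: M)
qed auto

lemma nn_integral_plane_radial:
  assumes [measurable]: "h \<in> borel_measurable borel"
  shows "(\<integral>\<^sup>+z. h ((norm (z::real \<times> real))\<^sup>2) \<partial>lborel) = ennreal pi * (\<integral>\<^sup>+t. h t * indicator {0..} t \<partial>lborel)"
proof -
  have "(\<integral>\<^sup>+z. h ((norm (z::real \<times> real))\<^sup>2) \<partial>lborel)
      = (\<integral>\<^sup>+t. h t \<partial>distr lborel borel (\<lambda>z::real \<times> real. (norm z)\<^sup>2))"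
    by (simp add: nn_integral_distr)
  also have "\<dots> = (\<integral>\<^sup>+t. ennreal pi * (h t * indicator {0..} t) \<partial>lborel)"
    unfolding distr_norm_sq_plane by (simp add: nn_integral_density ac_simps)
  finally show ?thesis by (simp add: nn_integral_cmult)
qed

text \<open>Applies the planar formula to the pairs \<open>(x2, x3)\<close> and
  \<open>(x0, x1)\<close> in turn; each contributes a factor \<open>pi\<close>.\<close>

lemma nn_integral_quat_radial:
  fixes h :: "real \<Rightarrow> real \<Rightarrow> ennreal"
  assumes h[measurable]: "case_prod h \<in> borel_measurable (borel \<Otimes>\<^sub>M borel)"
  shows "(\<integral>\<^sup>+x. (case x of (x0, x1, x2, x3) \<Rightarrow> h (x0\<^sup>2 + x1\<^sup>2) (x2\<^sup>2 + x3\<^sup>2)) \<partial>lborel)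
    = ennreal (pi\<^sup>2) * (\<integral>\<^sup>+q. \<integral>\<^sup>+p. h p q * indicator {0..} p * indicator {0..} q \<partial>lborel \<partial>lborel)"
proof -
  have [measurable]: "(\<lambda>q. h p q) \<in> borel_measurable borel" for p
    using measurable_compose[OF measurable_Pair1', of p borel "case_prod h"] h by simp
  have [measurable]: "(\<lambda>p. h p q) \<in> borel_measurable borel" for q
    using measurable_compose[OF measurable_Pair2', of q borel "case_prod h"] h by simp
  have n: "(norm (x, y))\<^sup>2 = x\<^sup>2 + y\<^sup>2" for x y :: real
    by (simp add: norm_Pair)
  have "(\<integral>\<^sup>+x. (case x of (x0, x1, x2, x3) \<Rightarrow> h (x0\<^sup>2 + x1\<^sup>2) (x2\<^sup>2 + x3\<^sup>2)) \<partial>lborel)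
     = (\<integral>\<^sup>+x0. \<integral>\<^sup>+x1. \<integral>\<^sup>+z. h (x0\<^sup>2 + x1\<^sup>2) ((norm (z :: real \<times> real))\<^sup>2) \<partial>lborel \<partial>lborel \<partial>lborel)"
    by (subst nn_integral_lborel_prod, simp add: borel_prod[symmetric],
        subst nn_integral_lborel_prod, simp add: borel_prod[symmetric],
        simp add: split_beta norm_prod_def)
  also have "\<dots> = (\<integral>\<^sup>+y. \<integral>\<^sup>+z. h ((norm (y :: real \<times> real))\<^sup>2) ((norm (z :: real \<times> real))\<^sup>2) \<partial>lborel \<partial>lborel)"
    by (subst nn_integral_lborel_prod[where f="\<lambda>y. \<integral>\<^sup>+z. h ((norm (y :: real \<times> real))\<^sup>2) ((norm (z :: real \<times> real))\<^sup>2) \<partial>lborel"])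
       (measurable, simp add: n)
  also have "\<dots> = (\<integral>\<^sup>+y. ennreal pi * (\<integral>\<^sup>+q. h ((norm (y :: real \<times> real))\<^sup>2) q * indicator {0..} q \<partial>lborel) \<partial>lborel)"
    by (simp add: nn_integral_plane_radial)
  also have "\<dots> = ennreal pi * (ennreal pi * (\<integral>\<^sup>+p. (\<integral>\<^sup>+q. h p q * indicator {0..} q \<partial>lborel) * indicator {0..} p \<partial>lborel))"
    by (subst nn_integral_cmult, simp,
        subst nn_integral_plane_radial[where h="\<lambda>p. \<integral>\<^sup>+q. h p q * indicator {0..} q \<partial>lborel"]) simp_all
  also have "\<dots> = ennreal (pi\<^sup>2) * (\<integral>\<^sup>+p. (\<integral>\<^sup>+q. h p q * indicator {0..} p * indicator {0..} q \<partial>lborel) \<partial>lborel)"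
    by (subst nn_integral_multc[symmetric]) (simp_all add: power2_eq_square ennreal_mult mult_ac)
  also have "(\<integral>\<^sup>+p. (\<integral>\<^sup>+q. h p q * indicator {0..} p * indicator {0..} q \<partial>lborel) \<partial>lborel)
     = (\<integral>\<^sup>+q. (\<integral>\<^sup>+p. h p q * indicator {0..} p * indicator {0..} q \<partial>lborel) \<partial>lborel)"
    by (rule nn_integral_lborel_Fubini) (simp add: borel_prod[symmetric] split_beta')
  finally show ?thesis .
qed

text \<open>The shear \<open>w = p + q\<close> followed by the scaling \<open>q = w * s\<close>
  turns the ratio into \<open>s\<close>, with Jacobian \<open>w\<close>; the factor 1/2 is the
  integral of \<open>w\<close> over the unit interval.\<close>

lemma nn_integral_triangle_ratio:
  fixes g :: "real \<Rightarrow> ennreal"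
  assumes [measurable]: "g \<in> borel_measurable borel"
  shows "(\<integral>\<^sup>+q. \<integral>\<^sup>+p. indicator {..<1} (p + q) * g (q / (p + q)) * indicator {0..} p * indicator {0..} q \<partial>lborel \<partial>lborel)
    = ennreal (1/2) * (\<integral>\<^sup>+s. g s * indicator {0..1} s \<partial>lborel)"
proof -
  let ?h = "\<lambda>p q. indicator {..<1} (p + q) * g (q / (p + q)) * indicator {0..} p * indicator {0..} q :: ennreal"
  define G where "G = (\<integral>\<^sup>+s. g s * indicator {0..1} s \<partial>lborel)"
  have "(\<integral>\<^sup>+q. \<integral>\<^sup>+p. ?h p q \<partial>lborel \<partial>lborel) = (\<integral>\<^sup>+q. \<integral>\<^sup>+w. ?h (- q + w) q \<partial>lborel \<partial>lborel)"
    by (intro nn_integral_cong nn_integral_lborel_plus[symmetric]) simp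
  also have "\<dots> = (\<integral>\<^sup>+w. \<integral>\<^sup>+q. ?h (- q + w) q \<partial>lborel \<partial>lborel)"
    by (rule nn_integral_lborel_Fubini) (simp add: borel_prod[symmetric] split_beta')
  also have "\<dots> = (\<integral>\<^sup>+w. G * (ennreal w * indicator {0..1} w) \<partial>lborel)"
  proof (rule nn_integral_cong_AE)
    \<comment> \<open>At \<open>w = 0\<close> the scaling degenerates; at \<open>w = 1\<close> the
      strict bound \<open>p + q < 1\<close> clashes with the closed interval on the right.\<close>
    have "AE w in lborel. w \<noteq> (0::real)" "AE w in lborel. w \<noteq> (1::real)"
      by (rule AE_lborel_singleton)+
    then show "AE w in lborel. (\<integral>\<^sup>+q. ?h (- q + w) q \<partial>lborel) = G * (ennreal w * indicator {0..1} w)"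
    proof eventually_elim
      case (elim w)
      show ?case
      proof (cases "0 < w \<and> w < 1")
        case True
        then have "(\<integral>\<^sup>+q. ?h (- q + w) q \<partial>lborel) = ennreal w * (\<integral>\<^sup>+s. ?h (- (0 + w * s) + w) (0 + w * s) \<partial>lborel)"
          by (subst nn_integral_real_affine[where c=w and t=0]) auto
        also have "(\<integral>\<^sup>+s. ?h (- (0 + w * s) + w) (0 + w * s) \<partial>lborel) = G"
          unfolding G_def using True
          by (intro nn_integral_cong) (auto simp: indicator_def zero_le_mult_iff)
        finally show ?thesis using True by (simp add: mult.commute)
      next
        case False
        then have "(\<integral>\<^sup>+q. ?h (- q + w) q \<partial>lborel) = (\<integral>\<^sup>+(q::real). 0 \<partial>lborel)"
          using elim by (intro nn_integral_cong) (auto simp: indicator_def)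
        then show ?thesis using False elim by (auto simp: indicator_def)
      qed
    qed
  qed
  also have "\<dots> = G * (\<integral>\<^sup>+w. ennreal w * indicator {0..1} w \<partial>lborel)"
    by (simp add: nn_integral_cmult)
  also have "(\<integral>\<^sup>+w. ennreal w * indicator {0..1} w \<partial>lborel) = ennreal (1\<^sup>2 / 2 - 0\<^sup>2 / 2)"
    by (rule nn_integral_FTC_Icc) (auto intro!: derivative_eq_intros)
  finally show ?thesis by (simp add: G_def mult.commute)
qed

text \<open>The Householder reflection along \<open>u - v\<close>; for \<open>u = v\<close> division by zero turns it into the
  identity.\<close>

lemma orthogonal_transformation_swap:
  fixes u v :: "'a::real_inner"
  assumes "norm u = norm v"
  obtains f where "orthogonal_transformation f" "f u = v"
    "\<And>x. x \<bullet> u = 0 \<Longrightarrow> x \<bullet> v = 0 \<Longrightarrow> f x = x"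
proof
  define w where "w = u - v"
  let ?f = "\<lambda>x. x - (2 * (w \<bullet> x) / (w \<bullet> w)) *\<^sub>R w"
  show "orthogonal_transformation ?f"
    unfolding orthogonal_transformation_def
  proof
    show "linear ?f"
      by (rule linearI) (simp_all add: inner_add_right algebra_simps add_divide_distrib)
    show "\<forall>x y. ?f x \<bullet> ?f y = x \<bullet> y"
      by (cases "w = 0") (simp_all add: inner_diff_left inner_diff_right inner_commute field_simps)
  qed
  have "u \<bullet> u = v \<bullet> v"
    using assms by (simp add: norm_eq_sqrt_inner)
  then have "2 * (w \<bullet> u) = w \<bullet> w"
    by (simp add: w_def inner_diff_left inner_diff_right inner_commute)
  then have "?f u = u - w"
    by (cases "w = 0") simp_all
  then show "?f u = v"
    by (simp add: w_def)
  show "?f x = x" if "x \<bullet> u = 0" "x \<bullet> v = 0" for x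
  proof -
    have "w \<bullet> x = 0"
      using that by (simp add: w_def inner_diff_right inner_commute[of _ x])
    then show ?thesis by simp
  qed
qed

section \<open>The logarithmic integral over the unit interval\<close>

text \<open>At the endpoint the value \<open>0 * ln 0 = 0\<close> is also the limit; this makes the
  antiderivative below continuous when \<open>k = 0\<close>.\<close>

lemma continuous_on_mult_ln: "continuous_on {0..} (\<lambda>y::real. y * ln y)"
  unfolding continuous_on_def
proof
  fix x :: real assume "x \<in> {0..}"
  show "((\<lambda>y. y * ln y) \<longlongrightarrow> x * ln x) (at x within {0..})"
  proof (cases "x = 0")
    case True
    have "((\<lambda>y::real. y * ln y) \<longlongrightarrow> 0) (at_right 0)"
      by real_asymp
    then show ?thesis using True
      by (simp add: at_within_Ici_at_right)
  next
    case False
    then show ?thesis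
      using \<open>x \<in> {0..}\<close> by (auto intro!: tendsto_intros)
  qed
qed

text \<open>For \<open>k = 0\<close> the integrand is unbounded near 0, but its antiderivative
  \<open>F\<close> is continuous on the closed interval; hence the fundamental theorem with
  derivatives in the interior only.\<close>

lemma set_lebesgue_integral_ln:
  fixes k :: real
  assumes k: "0 \<le> k"
  shows "set_integrable lborel {0..1} (\<lambda>s. ln (k + 4 * s))"
    and "(LINT s:{0..1}|lborel. ln (k + 4 * s)) = ((4 + k) * ln (4 + k) - k * ln k) / 4 - 1"
proof -
  define F where "F s = ((k + 4 * s) * ln (k + 4 * s)) / 4 - s" for s
  have "((\<lambda>s. ln (k + 4 * s)) has_integral (F 1 - F 0)) {0..1}"
  proof (rule fundamental_theorem_of_calculus_interior)
    have "continuous_on {0..1} (\<lambda>s. (k + 4 * s) * ln (k + 4 * s))"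
      using k by (intro continuous_on_compose2[OF continuous_on_mult_ln] continuous_intros) auto
    then show "continuous_on {0..1} F"
      unfolding F_def by (intro continuous_on_diff continuous_on_divide continuous_on_const continuous_on_id) auto
    show "(F has_vector_derivative ln (k + 4 * s)) (at s)" if "s \<in> {0<..<1}" for s
    proof -
      have "k + 4 * s > 0" "k * 16 + 64 * s \<noteq> 0" using that k by auto
      then show ?thesis
        unfolding F_def has_real_derivative_iff_has_vector_derivative[symmetric]
        by (auto intro!: derivative_eq_intros simp: add_divide_distrib) (simp add: field_simps)
    qed
  qed simp
  moreover have "F 1 - F 0 = ((4 + k) * ln (4 + k) - k * ln k) / 4 - 1"
    by (simp add: F_def field_simps)
  ultimately have I: "((\<lambda>s. ln (k + 4 * s)) has_integral (((4 + k) * ln (4 + k) - k * ln k) / 4 - 1)) {0..1}"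
    by simp
  \<comment> \<open>Only the difference from the maximum has a sign, also at the junk value \<open>ln 0 = 0\<close>.\<close>
  have "(\<lambda>s. ln (k + 4) - ln (k + 4 * s)) absolutely_integrable_on {0..1}"
  proof (rule nonnegative_absolutely_integrable_1)
    show "(\<lambda>s. ln (k + 4) - ln (k + 4 * s)) integrable_on {0..1}"
      using I by (intro integrable_diff integrable_const_ivl) (auto simp: has_integral_integrable)
    show "0 \<le> ln (k + 4) - ln (k + 4 * s)" if "s \<in> {0..1}" for s
      using that k by (cases "k + 4 * s = 0") auto
  qed
  then have "set_integrable lborel {0..1} (\<lambda>s. ln (k + 4) - ln (k + 4 * s))"
    unfolding set_integrable_def by (subst (asm) integrable_completion) auto
  moreover have "set_integrable lborel {0..1} (\<lambda>s::real. ln (k + 4))"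
    by (simp add: set_integrable_def)
  ultimately have "set_integrable lborel {0..1} (\<lambda>s. ln (k + 4) - (ln (k + 4) - ln (k + 4 * s)))"
    by (rule set_integral_diff(1)[rotated])
  then show *: "set_integrable lborel {0..1} (\<lambda>s. ln (k + 4 * s))"
    by simp
  show "(LINT s:{0..1}|lborel. ln (k + 4 * s)) = ((4 + k) * ln (4 + k) - k * ln k) / 4 - 1"
    using set_borel_integral_eq_integral(2)[OF *] I by (simp add: integral_unique)
qed

section \<open>The uniform distribution of \<open>sin_sq\<close>\<close>

text \<open>For \<open>|v| = 1\<close> and \<open>v\<close> orthogonal to \<open>1\<close>, the squared sine of the angle between \<open>x\<close> and the plane spanned by
  \<open>1\<close> and \<open>v\<close>; it is \<open>0\<close> at \<open>x = 0\<close>.\<close>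

abbreviation sin_sq :: "quat \<Rightarrow> quat \<Rightarrow> real" where
  "sin_sq v x \<equiv> ((norm x)\<^sup>2 - (x \<bullet> qreal 1)\<^sup>2 - (x \<bullet> v)\<^sup>2) / (norm x)\<^sup>2"

text \<open>By orthogonal invariance \<open>v\<close> may be taken as the unit \<open>i\<close>.
  With \<open>p\<close> and \<open>q\<close> the squared lengths in the two coordinate planes,
  \<open>sin_sq\<close> is \<open>q / (p + q)\<close> and the ball is
  \<open>p + q < 1\<close>.\<close>

lemma nn_integral_ball_sin_sq:
  fixes v :: quat and g :: "real \<Rightarrow> ennreal"
  assumes v: "norm v = 1" "qreal 1 \<bullet> v = 0" and [measurable]: "g \<in> borel_measurable borel"
  shows "(\<integral>\<^sup>+x. g (sin_sq v x) * indicator (ball 0 1) x \<partial>lborel)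
    = ennreal (pi\<^sup>2 / 2) * (\<integral>\<^sup>+s. g s * indicator {0..1} s \<partial>lborel)"
proof -
  define e :: quat where "e = (0, 1, 0, 0)"
  have "norm v = norm e"
    by (simp add: v e_def norm_Pair)
  \<comment> \<open>The reflection fixes \<open>qreal 1\<close>, which is orthogonal to both
    \<open>v\<close> and \<open>e\<close>.\<close>
  then obtain f where f: "orthogonal_transformation f" "f v = e" and f1: "f (qreal 1) = qreal 1"
  proof (rule orthogonal_transformation_swap)
    fix f assume "orthogonal_transformation f" "f v = e"
      and "\<And>x. x \<bullet> v = 0 \<Longrightarrow> x \<bullet> e = 0 \<Longrightarrow> f x = x"
    moreover have "qreal 1 \<bullet> e = 0" by (simp add: e_def qreal_def)
    ultimately show thesis using that v(2) by blast
  qed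
  have [measurable]: "f \<in> borel_measurable borel"
    using f(1) by (rule borel_measurable_orthogonal_transformation)
  have n: "norm (f x) = norm x" for x
    using f(1) by (simp add: orthogonal_transformation_norm)
  have inner: "f x \<bullet> e = x \<bullet> v" "f x \<bullet> qreal 1 = x \<bullet> qreal 1" for x
    using f f1 by (metis orthogonal_transformation_def)+
  have [measurable]: "ball (0::quat) 1 \<in> sets borel"
    by simp
  let ?h = "\<lambda>p q. indicator {..<1} (p + q) * g (q / (p + q)) :: ennreal"
  have "(\<integral>\<^sup>+x. g (sin_sq v x) * indicator (ball 0 1) x \<partial>lborel)
      = (\<integral>\<^sup>+x. g (sin_sq e (f x)) * indicator (ball 0 1) (f x) \<partial>lborel)"
    by (simp add: n inner indicator_def)
  also have "\<dots> = (\<integral>\<^sup>+x. g (sin_sq e x) * indicator (ball 0 1) x \<partial>distr lborel borel f)"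
    by (rule nn_integral_distr[symmetric]) measurable
  also have "\<dots> = (\<integral>\<^sup>+x. g (sin_sq e x) * indicator (ball 0 1) x \<partial>lborel)"
    by (simp add: distr_orthogonal_transformation_lborel[OF f(1)])
  also have "\<dots> = (\<integral>\<^sup>+x. (case x of (x0, x1, x2, x3) \<Rightarrow> ?h (x0\<^sup>2 + x1\<^sup>2) (x2\<^sup>2 + x3\<^sup>2)) \<partial>lborel)"
  proof (rule nn_integral_cong)
    fix x :: quat
    obtain x0 x1 x2 x3 where x: "x = (x0, x1, x2, x3)" by (cases x) auto
    have sq: "(norm x)\<^sup>2 = (x0\<^sup>2 + x1\<^sup>2) + (x2\<^sup>2 + x3\<^sup>2)"
      by (simp add: x norm_Pair)
    have "norm x < 1 \<longleftrightarrow> (norm x)\<^sup>2 < 1"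
      by (simp add: abs_square_less_1)
    then show "g (sin_sq e x) * indicator (ball 0 1) x
        = (case x of (x0, x1, x2, x3) \<Rightarrow> ?h (x0\<^sup>2 + x1\<^sup>2) (x2\<^sup>2 + x3\<^sup>2))"
      unfolding sq by (simp add: x e_def qreal_def indicator_def)
  qed
  also have "\<dots> = ennreal (pi\<^sup>2) * (\<integral>\<^sup>+q. \<integral>\<^sup>+p. ?h p q * indicator {0..} p * indicator {0..} q \<partial>lborel \<partial>lborel)"
    by (rule nn_integral_quat_radial) simp
  also have "\<dots> = ennreal (pi\<^sup>2) * (ennreal (1/2) * (\<integral>\<^sup>+s. g s * indicator {0..1} s \<partial>lborel))"
    by (simp add: nn_integral_triangle_ratio)
  also have "\<dots> = ennreal (pi\<^sup>2 / 2) * (\<integral>\<^sup>+s. g s * indicator {0..1} s \<partial>lborel)"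
  proof -
    have "ennreal (pi\<^sup>2) * ennreal (1/2) = ennreal (pi\<^sup>2 / 2)"
      by (subst ennreal_mult[symmetric]) auto
    then show ?thesis
      by (simp only: mult.assoc[symmetric])
  qed
  finally show ?thesis .
qed

text \<open>The previous lemma for indicator functions identifies a pushforward measure, which then
  transfers integrals of a signed \<open>G\<close>; the constant \<open>pi\<^sup>2 / 2\<close>
  cancels against the volume of the ball.\<close>

lemma haar_integral_sin_sq:
  fixes v :: quat and G :: "real \<Rightarrow> real"
  assumes v: "norm v = 1" "qreal 1 \<bullet> v = 0" and [measurable]: "G \<in> borel_measurable borel"
    and f: "\<And>x. f (x /\<^sub>R norm x) = G (sin_sq v x)"
  shows "haar_integral f = (LINT s:{0..1}|lborel. G s)"
proof -
  have [measurable]: "sin_sq v \<in> borel_measurable borel"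
    by measurable
  have B: "ennreal (indicator (ball (0::quat) 1) x) = indicator (ball 0 1) x" for x
    by (simp add: indicator_def)
  have "distr (density lborel (\<lambda>x. indicator (ball 0 1) x)) borel (sin_sq v)
      = density lborel (\<lambda>s. ennreal (pi\<^sup>2 / 2 * indicator {0..1} s))"
    (is "distr ?B _ _ = ?U")
  proof (rule measure_eqI)
    fix A assume "A \<in> sets (distr ?B borel (sin_sq v))"
    then have [measurable]: "A \<in> sets borel" by simp
    have "emeasure (distr ?B borel (sin_sq v)) A = (\<integral>\<^sup>+x. indicator A (sin_sq v x) \<partial>?B)"
      by (subst nn_integral_indicator[symmetric], simp, subst nn_integral_distr) auto
    also have "\<dots> = (\<integral>\<^sup>+x. indicator A (sin_sq v x) * indicator (ball 0 1) x \<partial>lborel)"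
      by (subst nn_integral_density) (auto simp: mult.commute borel_measurable_indicator)
    also have "\<dots> = ennreal (pi\<^sup>2 / 2) * (\<integral>\<^sup>+s. indicator A s * indicator {0..1} s \<partial>lborel)"
      by (rule nn_integral_ball_sin_sq[OF v]) simp
    also have "\<dots> = emeasure ?U A"
      by (subst emeasure_density, simp, simp, subst nn_integral_cmult[symmetric], simp)
         (auto intro!: nn_integral_cong simp: indicator_def)
    finally show "emeasure (distr ?B borel (sin_sq v)) A = emeasure ?U A" .
  qed simp
  note D = this
  have "(LINT x:ball 0 1|lborel. f (x /\<^sub>R norm x)) = (LINT x|density lborel (\<lambda>x. ennreal (indicator (ball 0 1) x)). G (sin_sq v x))"
    unfolding set_lebesgue_integral_def f by (subst integral_density) (auto simp: borel_measurable_indicator)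
  also have "\<dots> = (LINT s|density lborel (\<lambda>s. ennreal (pi\<^sup>2 / 2 * indicator {0..1} s)). G s)"
    unfolding D[symmetric] B by (subst integral_distr) auto
  also have "\<dots> = pi\<^sup>2 / 2 * (LINT s:{0..1}|lborel. G s)"
    unfolding set_lebesgue_integral_def by (subst integral_density) (auto simp: mult.assoc)
  finally have I: "(LINT x:ball 0 1|lborel. f (x /\<^sub>R norm x)) = pi\<^sup>2 / 2 * (LINT s:{0..1}|lborel. G s)" .
  \<comment> \<open>The constant function 1 recovers the volume of the unit ball.\<close>
  have "emeasure lborel (ball (0::quat) 1) = ennreal (pi\<^sup>2 / 2)"
    using nn_integral_ball_sin_sq[OF v, of "\<lambda>_. 1"] by simp
  then have V: "measure lborel (ball (0::quat) 1) = pi\<^sup>2 / 2"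
    by (simp add: measure_def)
  show ?thesis
    unfolding haar_integral_def I V by simp
qed

section \<open>The norm of the commutator and the Mahler measure\<close>

text \<open>The commutator is purely imaginary, so \<open>c\<close> contributes orthogonally. The
  rest is Lagrange's identity for the cross product of the imaginary parts, doubled.\<close>

lemma norm_commutator_sq:
  fixes a x :: quat
  shows "(norm (qmul a x - qmul x a + qreal c))\<^sup>2
    = c\<^sup>2 + 4 * ((norm (qIm a))\<^sup>2 * ((norm x)\<^sup>2 - (x \<bullet> qreal 1)\<^sup>2) - (x \<bullet> qIm a)\<^sup>2)"
proof -
  have n: "(norm (p, q, r, s))\<^sup>2 = p\<^sup>2 + q\<^sup>2 + r\<^sup>2 + s\<^sup>2" for p q r s :: real
    by (simp add: norm_Pair)
  have n': "(norm (q, r, s))\<^sup>2 = q\<^sup>2 + r\<^sup>2 + s\<^sup>2" for q r s :: real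
    by (simp add: norm_Pair)
  obtain a0 a1 a2 a3 x0 x1 x2 x3 where "a = (a0, a1, a2, a3)" "x = (x0, x1, x2, x3)"
    by (cases a; cases x) auto
  then show ?thesis
    by (simp add: n n' qreal_def) (simp add: power2_eq_square algebra_simps)
qed

theorem theorem6p3:
  fixes a :: quat and c :: real
  assumes "qIm a \<noteq> 0"
  defines "c0 \<equiv> \<bar>c\<bar> / norm (qIm a)"
  shows "mahler_H (\<lambda>x. qmul a x - qmul x a + qreal c) =
           ln (norm (qIm a)) +
           (1/8) * ((4 + c0^2) * ln (4 + c0^2)
                    - 2 * (if c0 = 0 then 0 else c0^2 * ln c0) - 4)"
proof -
  define r where "r = norm (qIm a)"
  define v where "v = qIm a /\<^sub>R r"
  \<comment> \<open>The factor \<open>r\<^sup>2\<close> stays inside the logarithm so that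
    \<open>G\<close> matches the integrand at every point, also where the argument is 0.\<close>
  define G where "G s = 1 / 2 * ln (r\<^sup>2 * (c0\<^sup>2 + 4 * s))" for s
  have r: "r > 0" using assms by (simp add: r_def)
  have v: "norm v = 1" "qreal 1 \<bullet> v = 0"
    using r by (auto simp: v_def r_def qreal_def) (cases a; simp)
  have qv: "qIm a = r *\<^sub>R v" using r by (simp add: v_def)
  have c: "c\<^sup>2 = r\<^sup>2 * c0\<^sup>2"
    using r by (simp add: c0_def r_def[symmetric] power_divide)
  \<comment> \<open>At \<open>x = 0\<close> both the normalized vector and \<open>sin_sq v x\<close>
    are 0 by division by zero, and both sides reduce to \<open>c\<^sup>2\<close>.\<close>
  have N: "(norm (qmul a (x /\<^sub>R norm x) - qmul (x /\<^sub>R norm x) a + qreal c))\<^sup>2 = r\<^sup>2 * (c0\<^sup>2 + 4 * sin_sq v x)" for x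
    unfolding norm_commutator_sq r_def[symmetric] c
    by (cases "x = 0") (simp_all add: qv field_simps power2_eq_square)
  have ln_sq: "ln y = 1 / 2 * ln (y\<^sup>2)" if "y \<ge> 0" for y :: real
    using that by (cases "y = 0") (simp_all add: ln_realpow)
  have "mahler_H (\<lambda>x. qmul a x - qmul x a + qreal c) = (LINT s:{0..1}|lborel. G s)"
    unfolding mahler_H_def
  proof (rule haar_integral_sin_sq[OF v])
    show "G \<in> borel_measurable borel" unfolding G_def by measurable
    show "ln (norm (qmul a (x /\<^sub>R norm x) - qmul (x /\<^sub>R norm x) a + qreal c)) = G (sin_sq v x)" for x
      unfolding G_def N[symmetric] by (rule ln_sq) simp
  qed
  also have "\<dots> = ln r + 1 / 2 * (((4 + c0\<^sup>2) * ln (4 + c0\<^sup>2) - c0\<^sup>2 * ln (c0\<^sup>2)) / 4 - 1)"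
  proof -
    \<comment> \<open>At \<open>s = c0 = 0\<close> the two sides differ because \<open>ln 0 = 0\<close>.\<close>
    have "AE s in lborel. s \<noteq> (0::real)"
      by (rule AE_lborel_singleton)
    then have "AE s\<in>{0..1} in lborel. G s = ln r + 1 / 2 * ln (c0\<^sup>2 + 4 * s)"
    proof eventually_elim
      case (elim s)
      then have "c0\<^sup>2 + 4 * s > 0" if "s \<in> {0..1}"
        using that by (intro add_nonneg_pos) auto
      then show ?case
        using r by (auto simp: G_def ln_mult ln_realpow)
    qed
    then have "(LINT s:{0..1}|lborel. G s) = (LINT s:{0..1}|lborel. ln r + 1 / 2 * ln (c0\<^sup>2 + 4 * s))"
      unfolding G_def by (intro set_lebesgue_integral_cong_AE) auto
    also have "\<dots> = (LINT s:{0..1::real}|lborel. ln r) + (LINT s:{0..1}|lborel. 1 / 2 * ln (c0\<^sup>2 + 4 * s))"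
    proof (rule set_integral_add(2))
      show "set_integrable lborel {0..1} (\<lambda>s::real. ln r)"
        by (simp add: set_integrable_def)
      show "set_integrable lborel {0..1} (\<lambda>s. 1 / 2 * ln (c0\<^sup>2 + 4 * s))"
        using set_lebesgue_integral_ln(1)[of "c0\<^sup>2"] by simp
    qed
    finally show ?thesis
      by (simp add: set_lebesgue_integral_ln(2) set_lebesgue_integral_def[of _ _ "\<lambda>_. ln r"])
  qed
  \<comment> \<open>For \<open>c0 = 0\<close> the factor \<open>c0\<^sup>2\<close> kills the left
    side, in agreement with the convention on the right.\<close>
  also have "c0\<^sup>2 * ln (c0\<^sup>2) = 2 * (if c0 = 0 then 0 else c0\<^sup>2 * ln c0)"
    using r by (simp add: c0_def r_def ln_realpow)
  finally show ?thesis
    by (simp add: r_def field_simps)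
qed

end
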